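(* For every integer $n\ge0$, the Askey-Wilson moments for $d=0$ are $$2^n\mu_n(a,b,c,0;q) = \sum_{k=0}^{n} \left(\binom{n}{\frac{n-k}2}-\binom{n}{\frac{n-k}2-1}\right) \sum_{u+v+w+2t=k} a^u b^v c^w (-1)^{t} q^{\binom{t+1}2} \begin{bmatrix} u+v+t\\ v\end{bmatrix}_q \begin{bmatrix} v+w+t\\ w\end{bmatrix}_q \begin{bmatrix} w+u+t\\ u\end{bmatrix}_q,$$ where the second sum is over all integers $0\le u,v,w\le k$ and $-k\le t\le k/2$ satisfying $u+v+w+2t=k$.
   Context: Let $a,b,c,d,q$ be indeterminates (generic parameters). The monic Askey-Wilson polynomials $P_n(x)=P_n(x;a,b,c,d;q)$ are defined by $P_{-1}=0$, $P_0=1$, $P_{n+1}=(x-b_n)P_n-\lambda_nP_{n-1}$, with $b_n=\frac12(a+a^{-1}-(A_n+C_n))$, $\lambda_n=\frac14A_{n-1}C_n$, where $$A_n=\frac{(1-abq^n)(1-acq^n)(1-adq^n)(1-abcdq^{n-1})}{a(1-abcdq^{2n-1})(1-abcdq^{2n})},\quad C_n=\frac{a(1-q^n)(1-bcq^{n-1})(1-bdq^{n-1})(1-cdq^{n-1})}{(1-abcdq^{2n-2})(1-abcdq^{2n-1})}$$ (for $n=0$ the common factor $1-abcdq^{-1}$ in $A_0$ is cancelled, and $C_0=0$). The moment $\mu_n(a,b,c,d;q)=L(x^n)$, where $L$ is the unique linear functional on polynomials in $x$ with $L(1)=1$ and $L(P_n)=0$ for all $n\ge1$ (so that $L(P_mP_n)=0$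 for $m\neq n$). It is a rational function of $a,b,c,d,q$, symmetric in $a,b,c,d$; here it is specialized at $d=0$. Notation: $(x;q)_m=\prod_{i=0}^{m-1}(1-xq^i)$; $\begin{bmatrix} n\\k\end{bmatrix}_q=\frac{(q;q)_n}{(q;q)_k(q;q)_{n-k}}$ if $0\le k\le n$ and $0$ otherwise. $\binom{n}{r}=0$ unless $r$ is an integer with $0\le r\le n$ (so only $k\equiv n\bmod 2$ contribute). In the exponent of $q$, $\binom{t+1}{2}=t(t+1)/2$ for every integer $t$. *)

theory Defs
  imports "HOL-Computational_Algebra.Polynomial"
begin

text \<open>The parameters are elements of an arbitrary field; an instance is a field of rational
  functions with the parameters as its indeterminates. Below, \<open>n - 1\<close> in an exponent is an integer
  subtraction, so \<open>powi\<close> is used where the exponent can be negative.\<close>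

definition aw_A :: "'a::field \<Rightarrow> 'a \<Rightarrow> 'a \<Rightarrow> 'a \<Rightarrow> 'a \<Rightarrow> nat \<Rightarrow> 'a" where
  "aw_A a b c d q n =
     (if n = 0 then (1 - a*b) * (1 - a*c) * (1 - a*d) / (a * (1 - a*b*c*d))
      else (1 - a*b*q^n) * (1 - a*c*q^n) * (1 - a*d*q^n) * (1 - a*b*c*d * q powi (int n - 1))
           / (a * (1 - a*b*c*d * q powi (2 * int n - 1)) * (1 - a*b*c*d * q powi (2 * int n))))"

definition aw_C :: "'a::field \<Rightarrow> 'a \<Rightarrow> 'a \<Rightarrow> 'a \<Rightarrow> 'a \<Rightarrow> nat \<Rightarrow> 'a" where
  "aw_C a b c d q n =
     (if n = 0 then 0
      else a * (1 - q^n) * (1 - b*c * q powi (int n - 1)) * (1 - b*d * q powi (int n - 1))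
             * (1 - c*d * q powi (int n - 1))
           / ((1 - a*b*c*d * q powi (2 * int n - 2)) * (1 - a*b*c*d * q powi (2 * int n - 1))))"

definition aw_b :: "'a::field \<Rightarrow> 'a \<Rightarrow> 'a \<Rightarrow> 'a \<Rightarrow> 'a \<Rightarrow> nat \<Rightarrow> 'a" where
  "aw_b a b c d q n = 1/2 * (a + inverse a - (aw_A a b c d q n + aw_C a b c d q n))"

text \<open>Only used for \<open>n \<ge> 1\<close>: the coefficient with index \<open>0\<close> multiplies \<open>P\<^sub>-\<^sub>1 = 0\<close>.\<close>

definition aw_lambda :: "'a::field \<Rightarrow> 'a \<Rightarrow> 'a \<Rightarrow> 'a \<Rightarrow> 'a \<Rightarrow> nat \<Rightarrow> 'a" where
  "aw_lambda a b c d q n = 1/4 * aw_A a b c d q (n - 1) * aw_C a b c d q n"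

fun aw_poly :: "'a::field \<Rightarrow> 'a \<Rightarrow> 'a \<Rightarrow> 'a \<Rightarrow> 'a \<Rightarrow> nat \<Rightarrow> 'a poly" where
  "aw_poly a b c d q 0 = 1"
| "aw_poly a b c d q (Suc 0) = [:0, 1:] - [:aw_b a b c d q 0:]"
| "aw_poly a b c d q (Suc (Suc n)) =
     ([:0, 1:] - [:aw_b a b c d q (Suc n):]) * aw_poly a b c d q (Suc n)
       - smult (aw_lambda a b c d q (Suc n)) (aw_poly a b c d q n)"

definition is_aw_functional ::
    "'a::field \<Rightarrow> 'a \<Rightarrow> 'a \<Rightarrow> 'a \<Rightarrow> 'a \<Rightarrow> ('a poly \<Rightarrow> 'a) \<Rightarrow> bool" where
  "is_aw_functional a b c d q L \<longleftrightarrow>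
     Vector_Spaces.linear smult (*) L \<and> L 1 = 1 \<and> (\<forall>n\<ge>1. L (aw_poly a b c d q n) = 0)"

definition aw_functional :: "'a::field \<Rightarrow> 'a \<Rightarrow> 'a \<Rightarrow> 'a \<Rightarrow> 'a \<Rightarrow> 'a poly \<Rightarrow> 'a" where
  "aw_functional a b c d q = (THE L. is_aw_functional a b c d q L)"

definition aw_moment :: "'a::field \<Rightarrow> 'a \<Rightarrow> 'a \<Rightarrow> 'a \<Rightarrow> 'a \<Rightarrow> nat \<Rightarrow> 'a" where
  "aw_moment a b c d q n = aw_functional a b c d q ([:0, 1:] ^ n)"

definition qpoch :: "'a::field \<Rightarrow> 'a \<Rightarrow> nat \<Rightarrow> 'a" where
  "qpoch x q m = (\<Prod>i<m. 1 - x * q^i)"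

text \<open>The arguments are integers because the upper argument may be negative.\<close>

definition qbinom :: "'a::field \<Rightarrow> int \<Rightarrow> int \<Rightarrow> 'a" where
  "qbinom q n k =
     (if 0 \<le> k \<and> k \<le> n then qpoch q q (nat n) / (qpoch q q (nat k) * qpoch q q (nat (n - k)))
      else 0)"

definition rbinom :: "nat \<Rightarrow> rat \<Rightarrow> int" where
  "rbinom n r = (if r \<in> \<int> \<and> 0 \<le> r \<and> r \<le> of_nat n then int (n choose nat \<lfloor>r\<rfloor>) else 0)"

definition aw_index_set :: "nat \<Rightarrow> (nat \<times> nat \<times> nat \<times> int) set" where
  "aw_index_set k =
     {(u, v, w, t). u \<le> k \<and> v \<le> k \<and> w \<le> k \<and> - int k \<le> t \<and> 2 * t \<le> int k \<and>
        int u + int v + int w + 2 * t = int k}"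

lemma finite_aw_index_set: "finite (aw_index_set k)"
proof (rule finite_subset)
  show "aw_index_set k \<subseteq> {..k} \<times> {..k} \<times> {..k} \<times> {- int k..int k}"
    unfolding aw_index_set_def by auto
qed auto

lemma aw_poly_monic:
  "degree (aw_poly a b c d q n) = n \<and> lead_coeff (aw_poly a b c d q n) = 1"
proof (induction a b c d q n rule: aw_poly.induct)
  case (3 a b c d q n)
  let ?x = "[:0, 1:] - [:aw_b a b c d q (Suc n):]"
  let ?p = "?x * aw_poly a b c d q (Suc n)"
  let ?r = "smult (aw_lambda a b c d q (Suc n)) (aw_poly a b c d q n)"
  have deg: "degree (aw_poly a b c d q (Suc n)) = Suc n" "degree (aw_poly a b c d q n) = n"
    and lc: "lead_coeff (aw_poly a b c d q (Suc n)) = 1"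
    using 3 by blast+
  have nz: "aw_poly a b c d q (Suc n) \<noteq> 0"
    using deg(1) by auto
  have x: "?x \<noteq> 0" "degree ?x = 1" "lead_coeff ?x = 1" by simp_all
  have p: "degree ?p = Suc (Suc n)"
    unfolding degree_mult_eq[OF x(1) nz] x(2) deg by simp
  have p': "lead_coeff ?p = 1"
    unfolding lead_coeff_mult x(3) lc by simp
  have less: "degree (- ?r) < degree ?p"
    unfolding p degree_minus
    using degree_smult_le[of "aw_lambda a b c d q (Suc n)" "aw_poly a b c d q n"] deg(2) by linarith
  have eq: "aw_poly a b c d q (Suc (Suc n)) = ?p + (- ?r)"
    by (simp only: aw_poly.simps diff_conv_add_uminus)
  have "degree (?p + (- ?r)) = degree ?p"
    using less by (rule degree_add_eq_left)
  moreover have "lead_coeff (- ?r + ?p) = lead_coeff ?p"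
    using less by (rule lead_coeff_add_le)
  ultimately show ?case
    unfolding eq using p p' by (simp only: add.commute)
qed simp_all

lemma ex1_aw_functional: "\<exists>!L. is_aw_functional a b c d q L"
proof -
  define P where "P = aw_poly a b c d q"
  have deg: "degree (P n) = n" and lc: "coeff (P n) n = 1" for n
    using aw_poly_monic[of a b c d q n] by (auto simp: P_def)
  have P0: "P 0 = 1" by (simp add: P_def)
  interpret V: vector_space_pair "smult :: 'a \<Rightarrow> 'a poly \<Rightarrow> 'a poly" "(*) :: 'a \<Rightarrow> 'a \<Rightarrow> 'a"
    by unfold_locales (auto simp: algebra_simps smult_add_left smult_add_right)
  have in_span: "p \<in> V.vs1.span (range P)" if "degree p < n" for p n
    using that
  proof (induction n arbitrary: p)
    case (Suc n)
    define r where "r = p - smult (coeff p n) (P n)"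
    have "coeff r i = 0" if "i \<ge> n" for i
      using that Suc.prems lc deg
      by (cases "i = n") (auto simp: r_def coeff_eq_0)
    then have "r = 0 \<or> degree r < n"
      by (metis leading_coeff_0_iff not_le)
    then have "r \<in> V.vs1.span (range P)"
      using Suc.IH V.vs1.span_zero by auto
    then have "r + smult (coeff p n) (P n) \<in> V.vs1.span (range P)"
      by (rule V.vs1.span_add) (intro V.vs1.span_scale V.vs1.span_base rangeI)
    then show ?case by (simp add: r_def)
  qed simp
  define m :: "nat \<Rightarrow> nat \<Rightarrow> 'a" where
    "m = rec_nat (\<lambda>_. 1) (\<lambda>n f i. if i \<le> n then f i else - (\<Sum>j\<le>n. coeff (P (Suc n)) j * f j))"
  have m0: "m 0 i = 1" for i by (simp add: m_def)
  have mS: "m (Suc n) i = (if i \<le> n then m n i else - (\<Sum>j\<le>n. coeff (P (Suc n)) j * m n j))" for n i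
    by (simp add: m_def)
  have stab: "m n i = m i i" if "i \<le> n" for n i
    using that by (induction n) (auto simp: mS le_Suc_eq)
  define L where "L p = (\<Sum>i\<le>degree p. coeff p i * m i i)" for p :: "'a poly"
  have L: "L p = (\<Sum>i\<le>N. coeff p i * m i i)" if "degree p \<le> N" for p N
    unfolding L_def using that by (intro sum.mono_neutral_left) (auto simp: coeff_eq_0)
  have lin: "Vector_Spaces.linear smult (*) L"
  proof -
    have "L (p + r) = L p + L r" for p r
    proof -
      let ?N = "max (degree p) (degree r)"
      show ?thesis
        using L[of p ?N] L[of r ?N] L[OF degree_add_le_max[of p r]]
        by (simp add: sum.distrib distrib_right)
    qed
    moreover have "L (smult s p) = s * L p" for s p
      unfolding L[OF degree_smult_le[of s p]] L[OF order_refl[of "degree p"]]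
      by (simp only: coeff_smult sum_distrib_left mult.assoc)
    ultimately show ?thesis
      unfolding Vector_Spaces.linear_iff
      by (intro conjI allI V.vs1.vector_space_axioms V.vs2.vector_space_axioms)
  qed
  have LP: "L (P n) = 0" if n: "n \<ge> 1" for n
  proof -
    obtain k where k: "n = Suc k" using n by (cases n) auto
    have "(\<Sum>j\<le>k. coeff (P n) j * m k j) = (\<Sum>j\<le>k. coeff (P n) j * m j j)"
      by (intro sum.cong refl arg_cong2[where f = "(*)"] stab) simp
    then show ?thesis
      unfolding L_def deg by (simp add: k mS lc)
  qed
  have "L 1 = 1" by (simp add: L_def m0)
  then have ex: "is_aw_functional a b c d q L"
    unfolding is_aw_functional_def P_def[symmetric] using lin LP by blast
  show ?thesis
  proof (rule ex1I[where P = "is_aw_functional a b c d q", OF ex])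
    fix L' assume "is_aw_functional a b c d q L'"
    then have L': "Vector_Spaces.linear smult (*) L'" "L' 1 = 1" "\<And>n. n \<ge> 1 \<Longrightarrow> L' (P n) = 0"
      unfolding is_aw_functional_def P_def by blast+
    have eq: "L' x = L x" if rx: "x \<in> range P" for x
    proof -
      obtain n where x: "x = P n" using rx by auto
      show ?thesis
        by (cases "n = 0") (simp_all add: x P0 L' LP \<open>L 1 = 1\<close>)
    qed
    show "L' = L"
    proof
      fix p
      show "L' p = L p"
        using L'(1) lin in_span[OF lessI] eq by (rule V.linear_eq_on)
    qed
  qed
qed

end

(*
  Expanding (2x)^n in Chebyshev polynomials U_k of the second kind, the claim is L(U_k) = S_k, where
  S_k = S_k(a) is the inner sum. Comparing coefficients of a^u b^v c^w gives
    (1 + a^2) S_k(a) - a (S_{k+1}(a) + S_{k-1}(a)) = (1 - ab)(1 - ac) S_k(aq)   (k >= 0).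
  Hence the functional M_a with M_a(U_k) = S_k(a) satisfies
    M_a((1 + a^2 - 2ax) p) = (1 - ab)(1 - ac) M_{aq}(p),
  and so M_a(phi_j) = (ab;q)_j (ac;q)_j for phi_j = prod_{i<j} (1 + a^2 q^{2i} - 2 a q^i x). As x phi_j is a
  combination of phi_j and phi_{j+1}, the recurrence of the Askey-Wilson polynomials yields by induction
    M_a(P_n phi_j) = (ab;q)_j (ac;q)_j (-a/2)^n (bc;q)_n prod_{i<n} (q^i - q^j),
  which vanishes at j = 0 < n. Thus M_a = L.
*)

theory Submission
  imports Defs "HOL-Library.Groups_Big_Fun"
begin

section \<open>q-factorials and the coefficients of the inner sums\<close>

definition qfac :: "'a::field \<Rightarrow> int \<Rightarrow> 'a" where
  "qfac q n = qpoch q q (nat n)"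

text \<open>With value \<open>0\<close> at negative integers, the reciprocal \<open>q\<close>-factorial satisfies its recurrence at
  every integer. The \<open>q\<close>-factorial itself (with junk value \<open>1\<close> there) fails it at \<open>n \<le> 0\<close>, whence the
  boundary cases of \<open>aw_coeff_rec\<close>.\<close>

definition qifac :: "'a::field \<Rightarrow> int \<Rightarrow> 'a" where
  "qifac q n = (if n < 0 then 0 else 1 / qpoch q q (nat n))"

definition aw_sign :: "'a::field \<Rightarrow> int \<Rightarrow> 'a" where
  "aw_sign q t = (- 1) powi t * q powi (t * (t + 1) div 2)"

text \<open>The sign times the three q-binomials, regrouped: a negative argument of any of the six
  reciprocals makes it vanish, and away from the boundary a shift of an index only costs an explicit
  factor.\<close>

definition aw_coeff :: "'a::field \<Rightarrow> int \<Rightarrow> int \<Rightarrow> int \<Rightarrow> int \<Rightarrow> 'a" where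
  "aw_coeff q u v w t = aw_sign q t *
     (qfac q (u + v + t) * qfac q (v + w + t) * qfac q (w + u + t)) *
     (qifac q u * qifac q v * qifac q w * qifac q (u + t) * qifac q (v + t) * qifac q (w + t))"

lemma qbinom_eq: "qbinom q n k = qfac q n * qifac q k * qifac q (n - k)"
  by (auto simp: qbinom_def qfac_def qifac_def)

lemma aw_coeff_qbinom:
  "aw_coeff q u v w t = aw_sign q t * qbinom q (u + v + t) v * qbinom q (v + w + t) w * qbinom q (w + u + t) u"
  unfolding aw_coeff_def qbinom_eq by (simp add: mult_ac algebra_simps)

lemma aw_coeff_eq_0:
  assumes "u < 0 \<or> v < 0 \<or> w < 0 \<or> u + t < 0 \<or> v + t < 0 \<or> w + t < 0"
  shows "aw_coeff q u v w t = 0"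
  using assms by (auto simp: aw_coeff_def qifac_def)

locale qgeneric =
  fixes q :: "'a::field_char_0"
  assumes q_nz: "q \<noteq> 0" and q_pow: "m \<ge> 1 \<Longrightarrow> q ^ m \<noteq> 1"
begin

lemma qpoch_nz: "qpoch q q m \<noteq> 0"
proof -
  have "1 - q * q ^ i \<noteq> 0" for i
    using q_pow[of "Suc i"] by simp
  then show ?thesis by (simp add: qpoch_def)
qed

lemma qfac_rec: "n \<ge> 1 \<Longrightarrow> qfac q n = (1 - q powi n) * qfac q (n - 1)"
proof -
  assume "n \<ge> 1"
  define m where "m = nat (n - 1)"
  have n: "n = int (Suc m)" using \<open>n \<ge> 1\<close> by (simp add: m_def)
  have "nat n = Suc m" "nat (n - 1) = m" using n by auto
  then show ?thesis unfolding qfac_def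
    by (simp add: qpoch_def n power_int_def nat_add_distrib)
qed

lemma qifac_rec: "qifac q (n - 1) = (1 - q powi n) * qifac q n"
proof (cases "n \<ge> 1")
  case True
  have "1 - q powi n \<noteq> 0"
    using qpoch_nz[of "nat n"] qfac_rec[OF True] by (auto simp: qfac_def)
  with True qfac_rec[OF True] qpoch_nz show ?thesis
    by (auto simp: qifac_def qfac_def field_simps)
next
  case False
  \<comment> \<open>At \<open>n = 0\<close> the factor 1 - q^0 vanishes, in accordance with the
    value 0 at -1.\<close>
  then show ?thesis by (cases "n = 0") (auto simp: qifac_def)
qed

lemma aw_sign_Suc: "aw_sign q (t + 1) = - (q * q powi t) * aw_sign q t"
proof -
  have "(t + 1) * (t + 1 + 1) = t * (t + 1) + (t + 1) * 2" by (simp add: algebra_simps)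
  then have "(t + 1) * (t + 1 + 1) div 2 = t * (t + 1) div 2 + (t + 1)"
    by (metis div_mult_self1 zero_neq_numeral add.commute)
  then show ?thesis using q_nz
    by (simp add: aw_sign_def power_int_add)
qed

text \<open>With a single nonzero index all three q-binomials are 1. These are the values that
  survive in the boundary cases of \<open>aw_coeff_rec\<close>.\<close>

lemma aw_coeff_axis: "u \<ge> 0 \<Longrightarrow> aw_coeff q u 0 0 0 = 1" "w \<ge> 0 \<Longrightarrow> aw_coeff q 0 0 w 0 = 1"
  "v \<ge> 0 \<Longrightarrow> aw_coeff q 0 v 0 0 = 1"
  using qpoch_nz by (auto simp: aw_coeff_def aw_sign_def qfac_def qifac_def qpoch_def)

text \<open>This compares the coefficients of a^u b^v c^w in the recurrence of S_k. The bounds make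
  \<open>qfac_rec\<close> applicable to all three factorials, so that a common factor splits off and
  a polynomial identity remains.\<close>

lemma aw_coeff_rec_generic:
  assumes "u + v + t \<ge> 1" "w + u + t \<ge> 1" "v + w + t \<ge> 0"
  shows "aw_coeff q u v w t * (1 - q powi u) + aw_coeff q (u - 2) v w (t + 1)
      - aw_coeff q (u - 1) v w (t + 1) - aw_coeff q (u - 1) v w t
      + q powi (u - 1) * (aw_coeff q (u - 1) (v - 1) w (t + 1) + aw_coeff q (u - 1) v (w - 1) (t + 1))
      - q powi (u - 2) * aw_coeff q (u - 2) (v - 1) (w - 1) (t + 2) = 0"
proof -
  define U V W Q where defs: "U = q powi u" "V = q powi v" "W = q powi w" "Q = q powi t"
  \<comment> \<open>Among the seven terms, each factorial is taken at its least argument and, in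
    \<open>D\<close>, each reciprocal at its greatest. Every term is then \<open>K\<close> times an
    explicit product.\<close>
  define N1 N2 N3 where N: "N1 = qfac q (u + v + t - 1)" "N2 = qfac q (v + w + t)" "N3 = qfac q (w + u + t - 1)"
  define D where D: "D = qifac q u * qifac q v * qifac q w * qifac q (u + t) * qifac q (v + t + 1) * qifac q (w + t + 1)"
  define K where "K = aw_sign q t * N1 * N2 * N3 * D"
  have fac: "qfac q (u + v + t) = (1 - U*V*Q) * N1" "qfac q (w + u + t) = (1 - U*W*Q) * N3"
      "qfac q (v + w + t + 1) = (1 - q*V*W*Q) * N2"
    using qfac_rec[of "u + v + t"] qfac_rec[of "w + u + t"] qfac_rec[of "v + w + t + 1"] assms q_nz
    by (simp_all add: defs N power_int_add mult_ac)
  have ifac1: "qifac q (u - 1) = (1 - U) * qifac q u" "qifac q (v - 1) = (1 - V) * qifac q v"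
     "qifac q (w - 1) = (1 - W) * qifac q w"
    by (simp_all add: qifac_rec defs)
  have ifac2: "qifac q (u - 2) = (1 - U) * (1 - U/q) * qifac q u"
    using qifac_rec[of "u - 1"] q_nz by (simp add: ifac1 defs power_int_diff)
  have ifac3: "qifac q (u + t - 1) = (1 - U*Q) * qifac q (u + t)"
    "qifac q (v + t) = (1 - q*V*Q) * qifac q (v + t + 1)"
    "qifac q (w + t) = (1 - q*W*Q) * qifac q (w + t + 1)"
    using qifac_rec[of "u + t"] qifac_rec[of "v + t + 1"] qifac_rec[of "w + t + 1"] q_nz
    by (simp_all add: defs power_int_add mult_ac)
  have t2: "t + 2 = t + 1 + 1" by simp
  have sg: "aw_sign q (t + 1) = - (q * Q) * aw_sign q t" "aw_sign q (t + 2) = q^3 * Q^2 * aw_sign q t"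
    unfolding t2 using q_nz
    by (simp_all only: aw_sign_Suc) (simp_all add: defs power_int_add power2_eq_square power3_eq_cube mult_ac)
  have T1: "aw_coeff q u v w t = K * ((1-U*V*Q)*(1-U*W*Q)*(1-q*V*Q)*(1-q*W*Q))"
    by (simp add: aw_coeff_def fac ifac3 K_def D N mult_ac)
  have T2: "aw_coeff q (u - 2) v w (t + 1) = K * (-(q*Q)*(1-q*V*W*Q)*(1-U)*(1-U/q)*(1-U*Q))"
  proof -
    have e: "u - 2 + v + (t + 1) = u + v + t - 1" "v + w + (t + 1) = v + w + t + 1"
      "w + (u - 2) + (t + 1) = w + u + t - 1" "u - 2 + (t + 1) = u + t - 1"
      "v + (t + 1) = v + t + 1" "w + (t + 1) = w + t + 1" by auto
    show ?thesis unfolding aw_coeff_def e sg ifac2 ifac3(1) fac(3) K_def D N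
      by (simp only: mult_ac)
  qed
  have T3: "aw_coeff q (u - 1) v w (t + 1) = K * (-(q*Q)*(1-U*V*Q)*(1-q*V*W*Q)*(1-U*W*Q)*(1-U))"
  proof -
    have e: "u - 1 + v + (t + 1) = u + v + t" "v + w + (t + 1) = v + w + t + 1"
      "w + (u - 1) + (t + 1) = w + u + t" "u - 1 + (t + 1) = u + t"
      "v + (t + 1) = v + t + 1" "w + (t + 1) = w + t + 1" by auto
    show ?thesis unfolding aw_coeff_def e sg ifac1 fac K_def D N
      by (simp only: mult_ac)
  qed
  have T4: "aw_coeff q (u - 1) v w t = K * ((1-U)*(1-U*Q)*(1-q*V*Q)*(1-q*W*Q))"
  proof -
    have e: "u - 1 + v + t = u + v + t - 1" 
      "w + (u - 1) + t = w + u + t - 1" "u - 1 + t = u + t - 1" by auto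
    show ?thesis unfolding aw_coeff_def e ifac1 ifac3 K_def D N
      by (simp only: mult_ac)
  qed
  have T5: "aw_coeff q (u - 1) (v - 1) w (t + 1) = K * (-(q*Q)*(1-U*W*Q)*(1-U)*(1-V)*(1-q*V*Q))"
  proof -
    have e: "u - 1 + (v - 1) + (t + 1) = u + v + t - 1" "v - 1 + w + (t + 1) = v + w + t"
      "w + (u - 1) + (t + 1) = w + u + t" "u - 1 + (t + 1) = u + t"
      "v - 1 + (t + 1) = v + t" "w + (t + 1) = w + t + 1" by auto
    show ?thesis unfolding aw_coeff_def e sg ifac1 ifac3(2) fac(2) K_def D N
      by (simp only: mult_ac)
  qed
  have T6: "aw_coeff q (u - 1) v (w - 1) (t + 1) = K * (-(q*Q)*(1-U*V*Q)*(1-U)*(1-W)*(1-q*W*Q))"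
  proof -
    have e: "u - 1 + v + (t + 1) = u + v + t" "v + (w - 1) + (t + 1) = v + w + t"
      "w - 1 + (u - 1) + (t + 1) = w + u + t - 1" "u - 1 + (t + 1) = u + t"
      "v + (t + 1) = v + t + 1" "w - 1 + (t + 1) = w + t" by auto
    show ?thesis unfolding aw_coeff_def e sg ifac1 ifac3(3) fac(1) K_def D N
      by (simp only: mult_ac)
  qed
  have T7: "aw_coeff q (u - 2) (v - 1) (w - 1) (t + 2) = K * (q^3*Q^2*(1-U)*(1-U/q)*(1-V)*(1-W))"
  proof -
    have e: "u - 2 + (v - 1) + (t + 2) = u + v + t - 1" "v - 1 + (w - 1) + (t + 2) = v + w + t"
      "w - 1 + (u - 2) + (t + 2) = w + u + t - 1" "u - 2 + (t + 2) = u + t"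
      "v - 1 + (t + 2) = v + t + 1" "w - 1 + (t + 2) = w + t + 1" by auto
    show ?thesis unfolding aw_coeff_def e sg ifac1 ifac2 K_def D N
      by (simp only: mult_ac)
  qed
  \<comment> \<open>In terms of q and U/q the divisions disappear: the last 1/q is absorbed by the
    q^3 that the sign at \<open>t + 2\<close> contributes.\<close>
  define X where "X = U / q"
  have X: "U = q * X" using q_nz by (simp add: X_def)
  have p: "q powi (u - 1) = X" "q powi (u - 2) = X / q"
    using q_nz by (simp_all add: X_def defs power_int_diff power2_eq_square)
  have X7: "X / q * (K * (q^3*Q^2*(1-U)*(1-X)*(1-V)*(1-W))) = X * (K * (q^2*Q^2*(1-U)*(1-X)*(1-V)*(1-W)))"
    using q_nz by (simp add: X_def power2_eq_square power3_eq_cube)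
  show ?thesis
    unfolding T1 T2 T3 T4 T5 T6 T7 p
    unfolding defs(1)[symmetric] X_def[symmetric]
    unfolding X7 unfolding X by algebra
qed

text \<open>Without the hypothesis this fails at \<open>(u, v, w, t) = (1, 0, 0, -1)\<close>.\<close>

lemma aw_coeff_rec:
  assumes "u + v + w + 2 * t \<ge> 0"
  shows "aw_coeff q u v w t * (1 - q powi u) + aw_coeff q (u - 2) v w (t + 1)
      - aw_coeff q (u - 1) v w (t + 1) - aw_coeff q (u - 1) v w t
      + q powi (u - 1) * (aw_coeff q (u - 1) (v - 1) w (t + 1) + aw_coeff q (u - 1) v (w - 1) (t + 1))
      - q powi (u - 2) * aw_coeff q (u - 2) (v - 1) (w - 1) (t + 2) = 0"
proof -
  \<comment> \<open>Outside the generic range the recurrence of a factorial may fail. There most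
    terms vanish, and the two that may remain cancel.\<close>
  consider "u + v + t \<ge> 1 \<and> w + u + t \<ge> 1 \<and> v + w + t \<ge> 0" | "v + w + t < 0" | "v + w + t \<ge> 0" "u + v + t < 1"
   | "v + w + t \<ge> 0" "w + u + t < 1" by linarith
  then show ?thesis
  proof cases
    case 1
    then show ?thesis using aw_coeff_rec_generic by blast
  next
    case 2
    have z: "aw_coeff q u v w t = 0" "aw_coeff q (u - 1) v w t = 0"
      "aw_coeff q (u - 1) (v - 1) w (t + 1) = 0" "aw_coeff q (u - 1) v (w - 1) (t + 1) = 0"
      "aw_coeff q (u - 2) (v - 1) (w - 1) (t + 2) = 0"
      by (rule aw_coeff_eq_0, use 2 in linarith)+
    \<comment> \<open>Nonzero values need v, w, v + t + 1, w + t + 1 >= 0. With v + w + t < 0 this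
      forces v = w = 0 and t = -1, and then the assumption gives u >= 2, so both values are
      1.\<close>
    have "aw_coeff q (u - 2) v w (t + 1) = aw_coeff q (u - 1) v w (t + 1)"
    proof (cases "v = 0 \<and> w = 0 \<and> t = -1")
      case True
      then show ?thesis using assms by (simp add: aw_coeff_axis)
    next
      case False
      have "aw_coeff q (u - 2) v w (t + 1) = 0" "aw_coeff q (u - 1) v w (t + 1) = 0"
        by (rule aw_coeff_eq_0, use False 2 in linarith)+
      then show ?thesis by simp
    qed
    with z show ?thesis by simp
  next
    case 3
    have z: "aw_coeff q (u - 2) v w (t + 1) = 0" "aw_coeff q (u - 1) v w t = 0"
      "aw_coeff q (u - 1) (v - 1) w (t + 1) = 0"
      "aw_coeff q (u - 2) (v - 1) (w - 1) (t + 2) = 0"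
      by (rule aw_coeff_eq_0, use 3 in linarith)+
    \<comment> \<open>For u >= 1 a nonzero coefficient needs v + t >= 0, against u + v + t < 1. At u
      = 0 the other factor vanishes.\<close>
    have "aw_coeff q u v w t * (1 - q powi u) = 0"
      by (cases "u = 0") (simp, use 3 in \<open>auto intro!: aw_coeff_eq_0\<close>)
    \<comment> \<open>Nonzero values force u = 1, v = 0, t = -1. There the power of q is 1 and both
      coefficients are axis values.\<close>
    moreover have "aw_coeff q (u - 1) v w (t + 1) = q powi (u - 1) * aw_coeff q (u - 1) v (w - 1) (t + 1)"
    proof (cases "u = 1 \<and> v = 0 \<and> t = -1")
      case True
      then show ?thesis using assms by (simp add: aw_coeff_axis)
    next
      case False
      have "aw_coeff q (u - 1) v w (t + 1) = 0" "aw_coeff q (u - 1) v (w - 1) (t + 1) = 0"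
        by (rule aw_coeff_eq_0, use False 3 in linarith)+
      then show ?thesis by simp
    qed
    ultimately show ?thesis using z by simp
  next
    case 4
    \<comment> \<open>This is the previous case with \<open>v\<close> and \<open>w\<close>
      exchanged.\<close>
    have z: "aw_coeff q (u - 2) v w (t + 1) = 0" "aw_coeff q (u - 1) v w t = 0"
      "aw_coeff q (u - 1) v (w - 1) (t + 1) = 0"
      "aw_coeff q (u - 2) (v - 1) (w - 1) (t + 2) = 0"
      by (rule aw_coeff_eq_0, use 4 in linarith)+
    have "aw_coeff q u v w t * (1 - q powi u) = 0"
      by (cases "u = 0") (simp, use 4 in \<open>auto intro!: aw_coeff_eq_0\<close>)
    moreover have "aw_coeff q (u - 1) v w (t + 1) = q powi (u - 1) * aw_coeff q (u - 1) (v - 1) w (t + 1)"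
    proof (cases "u = 1 \<and> w = 0 \<and> t = -1")
      case True
      then show ?thesis using assms by (simp add: aw_coeff_axis)
    next
      case False
      have "aw_coeff q (u - 1) v w (t + 1) = 0" "aw_coeff q (u - 1) (v - 1) w (t + 1) = 0"
        by (rule aw_coeff_eq_0, use False 4 in linarith)+
      then show ?thesis by simp
    qed
    ultimately show ?thesis using z by simp
  qed
qed

end

section \<open>The inner sums and their recurrence under a -> aq\<close>

text \<open>The index \<open>u\<close> is eliminated, so that the sum of degree \<open>k\<close> runs over all of \<open>\<int>\<^sup>3\<close> and
  multiplication by \<open>a\<close>, \<open>b\<close>, \<open>c\<close> becomes a translation. Where \<open>nat\<close> truncates,
  \<open>aw_coeff\<close> vanishes.\<close>

definition aw_term :: "'a::field \<Rightarrow> 'a \<Rightarrow> 'a \<Rightarrow> 'a \<Rightarrow> int \<Rightarrow> int \<Rightarrow> int \<Rightarrow> int \<Rightarrow> 'a" where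
  "aw_term a b c q k v w t =
     a powi (k - v - w - 2 * t) * b ^ nat v * c ^ nat w * aw_coeff q (k - v - w - 2 * t) v w t"

definition aw_sum :: "'a::field \<Rightarrow> 'a \<Rightarrow> 'a \<Rightarrow> 'a \<Rightarrow> int \<Rightarrow> 'a" where
  "aw_sum a b c q k = (\<Sum>(v, w, t). aw_term a b c q k v w t)"

text \<open>Put u = k - v - w - 2t. In a nonzero term all six reciprocal arguments are nonnegative,
  so k - v = (u + t) + (w + t) >= 0, likewise w <= k, and t >= -v >= -k.\<close>

lemma aw_term_eq_0:
  assumes "\<not> (0 \<le> v \<and> v \<le> k \<and> 0 \<le> w \<and> w \<le> k \<and> -k \<le> t \<and> 2 * t \<le> k)"
  shows "aw_term a b c q k v w t = 0"
proof -
  have "aw_coeff q (k - v - w - 2 * t) v w t = 0"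
    by (rule aw_coeff_eq_0) (use assms in linarith)
  then show ?thesis by (simp add: aw_term_def)
qed

text \<open>A translation by at most 2 keeps the support inside a box padded by 2. One box thus
  serves all eight sums in \<open>aw_sum_rec\<close>.\<close>

lemma aw_sum_shift:
  assumes "k \<le> K" "\<bar>i\<bar> \<le> 2" "\<bar>j\<bar> \<le> 2" "\<bar>l\<bar> \<le> 2"
  shows "aw_sum a b c q k =
    (\<Sum>(v, w, t)\<in>{-K-2..K+2} \<times> {-K-2..K+2} \<times> {-K-2..K+2}. aw_term a b c q k (v + i) (w + j) (t + l))"
    (is "_ = sum ?g ?A")
proof -
  have "aw_sum a b c q k = Sum_any ?g"
    unfolding aw_sum_def
  proof (rule Sum_any.reindex_cong)
    show "bij (\<lambda>(v, w, t). (v + i, w + j, t + l))"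
      by (rule bijI') (auto intro: diff_add_cancel[symmetric])
  qed auto
  also have "\<dots> = sum ?g ?A"
  proof (rule Sum_any.expand_superset)
    show "{x. ?g x \<noteq> 0} \<subseteq> ?A"
    proof
      fix x assume "x \<in> {x. ?g x \<noteq> 0}"
      then obtain v w t where x: "x = (v, w, t)" and nz: "aw_term a b c q k (v + i) (w + j) (t + l) \<noteq> 0"
        by (cases x rule: prod_cases3) auto
      have "0 \<le> v + i \<and> v + i \<le> k \<and> 0 \<le> w + j \<and> w + j \<le> k \<and> -k \<le> t + l \<and> 2 * (t + l) \<le> k"
        using aw_term_eq_0 nz by metis
      with assms show "x \<in> ?A" by (auto simp: x)
    qed
  qed auto
  finally show ?thesis .
qed

lemma aw_sum_negative: "k < 0 \<Longrightarrow> aw_sum a b c q k = 0"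
proof -
  assume "k < 0"
  then have "aw_term a b c q k v w t = 0" for v w t
    by (intro aw_term_eq_0) auto
  then show ?thesis by (simp add: aw_sum_def)
qed

text \<open>Forgetting \<open>u\<close> is injective because the degree condition recovers it. The
  bound u <= k holds on the support since k - u = (v + t) + (w + t).\<close>

lemma aw_sum_eq_index_set:
  assumes "a \<noteq> 0"
  shows "aw_sum a b c q (int k) = (\<Sum>(u, v, w, t)\<in>aw_index_set k.
          a ^ u * b ^ v * c ^ w * (- 1) powi t * q powi (t * (t + 1) div 2) *
          qbinom q (int u + int v + t) (int v) *
          qbinom q (int v + int w + t) (int w) *
          qbinom q (int w + int u + t) (int u))"
proof -
  define h :: "nat \<times> nat \<times> nat \<times> int \<Rightarrow> int \<times> int \<times> int" where "h = (\<lambda>(u, v, w, t). (int v, int w, t))"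
  have inj: "inj_on h (aw_index_set k)"
    by (auto simp: inj_on_def h_def aw_index_set_def)
  have "aw_sum a b c q (int k) = (\<Sum>(v, w, t)\<in>h ` aw_index_set k. aw_term a b c q (int k) v w t)"
    unfolding aw_sum_def
  proof (rule Sum_any.expand_superset)
    show "finite (h ` aw_index_set k)" by (simp add: finite_aw_index_set)
    show "{x. (case x of (v, w, t) \<Rightarrow> aw_term a b c q (int k) v w t) \<noteq> 0} \<subseteq> h ` aw_index_set k"
    proof
      fix x assume "x \<in> {x. (case x of (v, w, t) \<Rightarrow> aw_term a b c q (int k) v w t) \<noteq> 0}"
      then obtain v w t where x: "x = (v, w, t)" and nz: "aw_term a b c q (int k) v w t \<noteq> 0"
        by (cases x rule: prod_cases3) auto
      define u where "u = int k - v - w - 2 * t"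
      have "aw_coeff q u v w t \<noteq> 0" using nz by (auto simp: aw_term_def u_def)
      then have "\<not> (u < 0 \<or> v < 0 \<or> w < 0 \<or> u + t < 0 \<or> v + t < 0 \<or> w + t < 0)"
        using aw_coeff_eq_0 by metis
      then have "(nat u, nat v, nat w, t) \<in> aw_index_set k" "h (nat u, nat v, nat w, t) = x"
        by (auto simp: aw_index_set_def h_def x u_def)
      then show "x \<in> h ` aw_index_set k" by force
    qed
  qed
  also have "\<dots> = (\<Sum>x\<in>aw_index_set k. case h x of (v, w, t) \<Rightarrow> aw_term a b c q (int k) v w t)"
    by (rule sum.reindex[OF inj, unfolded o_def])
  also have "\<dots> = (\<Sum>(u, v, w, t)\<in>aw_index_set k.
          a ^ u * b ^ v * c ^ w * (- 1) powi t * q powi (t * (t + 1) div 2) *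
          qbinom q (int u + int v + t) (int v) *
          qbinom q (int v + int w + t) (int w) *
          qbinom q (int w + int u + t) (int u))"
  proof (rule sum.cong[OF refl])
    fix x assume "x \<in> aw_index_set k"
    then obtain u v w t where x: "x = (u, v, w, t)" and u: "int k - int v - int w - 2 * t = int u"
      by (auto simp: aw_index_set_def)
    show "(case h x of (v, w, t) \<Rightarrow> aw_term a b c q (int k) v w t) = (case x of (u, v, w, t) \<Rightarrow>
          a ^ u * b ^ v * c ^ w * (- 1) powi t * q powi (t * (t + 1) div 2) *
          qbinom q (int u + int v + t) (int v) *
          qbinom q (int v + int w + t) (int w) *
          qbinom q (int w + int u + t) (int u))"
      unfolding x h_def prod.case aw_term_def u aw_coeff_qbinom aw_sign_def
      by (simp add: mult.assoc)
  qed
  finally show ?thesis .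
qed

context qgeneric
begin

lemma aw_sum_0: "aw_sum a b c q 0 = 1"
proof -
  have "aw_sum a b c q 0 = (\<Sum>(v, w, t)\<in>{(0, 0, 0)}. aw_term a b c q 0 v w t)"
    unfolding aw_sum_def
  proof (rule Sum_any.expand_superset)
    show "{x. (case x of (v, w, t) \<Rightarrow> aw_term a b c q 0 v w t) \<noteq> 0} \<subseteq> {(0, 0, 0)}"
    proof
      fix x assume "x \<in> {x. (case x of (v, w, t) \<Rightarrow> aw_term a b c q 0 v w t) \<noteq> 0}"
      then obtain v w t where x: "x = (v, w, t)" and nz: "aw_term a b c q 0 v w t \<noteq> 0"
        by (cases x rule: prod_cases3) auto
      then show "x \<in> {(0, 0, 0)}"
        using aw_term_eq_0[of v 0 w t a b c q] nz by auto
    qed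
  qed auto
  then show ?thesis by (simp add: aw_term_def aw_coeff_axis)
qed

text \<open>The shifts are chosen so that every summand, with its prefactor, carries the same
  monomial a^u b^v c^w, where u = k - v - w - 2t. Dividing it out leaves
  \<open>aw_coeff_rec\<close>; the powers of q come from the argument aq.\<close>

lemma aw_term_rec:
  assumes "k \<ge> 0" "a \<noteq> 0"
  shows "aw_term a b c q k v w t + a^2 * aw_term a b c q k v w (t + 1)
     - a * aw_term a b c q (k + 1) v w (t + 1) - a * aw_term a b c q (k - 1) v w t
     - aw_term (a * q) b c q k v w t
     + a * b * aw_term (a * q) b c q k (v - 1) w (t + 1)
     + a * c * aw_term (a * q) b c q k v (w - 1) (t + 1)
     - a^2 * b * c * aw_term (a * q) b c q k (v - 1) (w - 1) (t + 2) = 0"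
proof -
  define u where "u = k - v - w - 2 * t"
  have e: "k - v - w - 2 * t = u" "k - v - w - 2 * (t + 1) = u - 2" "k + 1 - v - w - 2 * (t + 1) = u - 1"
    "k - 1 - v - w - 2 * t = u - 1" "k - (v - 1) - w - 2 * (t + 1) = u - 1"
    "k - v - (w - 1) - 2 * (t + 1) = u - 1" "k - (v - 1) - (w - 1) - 2 * (t + 2) = u - 2"
    by (simp_all add: u_def)
  have k: "u + v + w + 2 * t \<ge> 0" using assms by (simp add: u_def)
  have pa: "a powi (u - 1) = a powi u / a" "a powi (u - 2) = a powi u / a^2"
    using assms by (simp_all add: power_int_diff)
  define B C where BC: "B = b ^ nat v" "C = c ^ nat w"
  \<comment> \<open>For v <= 0 the truncated exponents do not match, but the coefficient at
    \<open>v - 1\<close> is zero.\<close>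
  have b: "b * (b ^ nat (v - 1) * aw_coeff q u' (v - 1) w' t') = B * aw_coeff q u' (v - 1) w' t'" for u' w' t'
  proof (cases "v \<ge> 1")
    case True
    then have "nat v = Suc (nat (v - 1))" by simp
    then show ?thesis by (simp add: BC)
  qed (simp add: aw_coeff_eq_0)
  have c: "c * (c ^ nat (w - 1) * aw_coeff q u' v' (w - 1) t') = C * aw_coeff q u' v' (w - 1) t'" for u' v' t'
  proof (cases "w \<ge> 1")
    case True
    then have "nat w = Suc (nat (w - 1))" by simp
    then show ?thesis by (simp add: BC)
  qed (simp add: aw_coeff_eq_0)
  have T1: "aw_term a b c q k v w t = a powi u * B * C * aw_coeff q u v w t"
    unfolding aw_term_def e BC ..
  have T2: "a^2 * aw_term a b c q k v w (t + 1) = a powi u * B * C * aw_coeff q (u - 2) v w (t + 1)"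
    unfolding aw_term_def e BC pa using assms by simp
  have T3: "a * aw_term a b c q (k + 1) v w (t + 1) = a powi u * B * C * aw_coeff q (u - 1) v w (t + 1)"
    unfolding aw_term_def e BC pa using assms by simp
  have T4: "a * aw_term a b c q (k - 1) v w t = a powi u * B * C * aw_coeff q (u - 1) v w t"
    unfolding aw_term_def e BC pa using assms by simp
  have T5: "aw_term (a * q) b c q k v w t = a powi u * B * C * (q powi u * aw_coeff q u v w t)"
    unfolding aw_term_def e BC by (simp add: power_int_mult_distrib mult_ac)
  have T6: "a * b * aw_term (a * q) b c q k (v - 1) w (t + 1)
      = a powi u * B * C * (q powi (u - 1) * aw_coeff q (u - 1) (v - 1) w (t + 1))"
  proof -
    have "a * b * aw_term (a * q) b c q k (v - 1) w (t + 1) =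
      a powi u * C * q powi (u - 1) * (b * (b ^ nat (v - 1) * aw_coeff q (u - 1) (v - 1) w (t + 1)))"
      unfolding aw_term_def e BC power_int_mult_distrib pa using assms by simp
    then show ?thesis unfolding b by (simp only: mult_ac)
  qed
  have T7: "a * c * aw_term (a * q) b c q k v (w - 1) (t + 1)
      = a powi u * B * C * (q powi (u - 1) * aw_coeff q (u - 1) v (w - 1) (t + 1))"
  proof -
    have "a * c * aw_term (a * q) b c q k v (w - 1) (t + 1) =
      a powi u * B * q powi (u - 1) * (c * (c ^ nat (w - 1) * aw_coeff q (u - 1) v (w - 1) (t + 1)))"
      unfolding aw_term_def e BC power_int_mult_distrib pa using assms by simp
    then show ?thesis unfolding c by (simp only: mult_ac)
  qed
  have T8: "a^2 * b * c * aw_term (a * q) b c q k (v - 1) (w - 1) (t + 2)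
      = a powi u * B * C * (q powi (u - 2) * aw_coeff q (u - 2) (v - 1) (w - 1) (t + 2))"
  proof -
    have "a^2 * b * c * aw_term (a * q) b c q k (v - 1) (w - 1) (t + 2) =
      a powi u * q powi (u - 2) * (b * (b ^ nat (v - 1) * (c * (c ^ nat (w - 1) *
         aw_coeff q (u - 2) (v - 1) (w - 1) (t + 2)))))"
      unfolding aw_term_def e power_int_mult_distrib pa using assms by simp
    also have "\<dots> = a powi u * q powi (u - 2) * C * (b * (b ^ nat (v - 1) *
         aw_coeff q (u - 2) (v - 1) (w - 1) (t + 2)))"
      unfolding c by (simp only: mult_ac)
    finally show ?thesis unfolding b by (simp only: mult_ac)
  qed
  let ?R = "aw_coeff q u v w t * (1 - q powi u) + aw_coeff q (u - 2) v w (t + 1)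
      - aw_coeff q (u - 1) v w (t + 1) - aw_coeff q (u - 1) v w t
      + q powi (u - 1) * (aw_coeff q (u - 1) (v - 1) w (t + 1) + aw_coeff q (u - 1) v (w - 1) (t + 1))
      - q powi (u - 2) * aw_coeff q (u - 2) (v - 1) (w - 1) (t + 2)"
  have "a powi u * B * C * ?R = 0"
    unfolding aw_coeff_rec[OF k] by simp
  then show ?thesis
    unfolding T1 T2 T3 T4 T5 T6 T7 T8 by algebra
qed

text \<open>Summation of \<open>aw_term_rec\<close> over all v, w, t: translates have equal sums, so
  the shifts disappear and the prefactors collect to the two polynomials in a, b, c.\<close>

lemma aw_sum_rec:
  assumes "k \<ge> 0" "a \<noteq> 0"
  shows "(1 + a^2) * aw_sum a b c q k - a * (aw_sum a b c q (k + 1) + aw_sum a b c q (k - 1))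
    = (1 - a * b) * (1 - a * c) * aw_sum (a * q) b c q k"
proof -
  define A where "A = {-(k+1)-2..(k+1)+2} \<times> {-(k+1)-2..(k+1)+2} \<times> {-(k+1)-2..(k+1)+2}"
  have sh: "aw_sum a b c q k' = (\<Sum>(v, w, t)\<in>A. aw_term a b c q k' (v + i) (w + j) (t + l))"
    if "k' \<le> k + 1" "\<bar>i\<bar> \<le> 2" "\<bar>j\<bar> \<le> 2" "\<bar>l\<bar> \<le> 2" for a k' i j l
    unfolding A_def using that by (rule aw_sum_shift)
  let ?S = "\<lambda>f. \<Sum>(v, w, t)\<in>A. f v w t"
  have eqs: "aw_sum a b c q k = ?S (aw_term a b c q k)"
    "aw_sum a b c q k = ?S (\<lambda>v w t. aw_term a b c q k v w (t + 1))"
    "aw_sum a b c q (k + 1) = ?S (\<lambda>v w t. aw_term a b c q (k + 1) v w (t + 1))"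
    "aw_sum a b c q (k - 1) = ?S (aw_term a b c q (k - 1))"
    "aw_sum (a * q) b c q k = ?S (aw_term (a * q) b c q k)"
    "aw_sum (a * q) b c q k = ?S (\<lambda>v w t. aw_term (a * q) b c q k (v - 1) w (t + 1))"
    "aw_sum (a * q) b c q k = ?S (\<lambda>v w t. aw_term (a * q) b c q k v (w - 1) (t + 1))"
    "aw_sum (a * q) b c q k = ?S (\<lambda>v w t. aw_term (a * q) b c q k (v - 1) (w - 1) (t + 2))"
    using sh[of k 0 0 0 a] sh[of k 0 0 1 a] sh[of "k+1" 0 0 1 a] sh[of "k-1" 0 0 0 a]
     sh[of k 0 0 0 "a*q"] sh[of k "-1" 0 1 "a*q"] sh[of k 0 "-1" 1 "a*q"] sh[of k "-1" "-1" 2 "a*q"]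
    by simp_all
  have "aw_sum a b c q k + a^2 * aw_sum a b c q k - a * aw_sum a b c q (k + 1) - a * aw_sum a b c q (k - 1)
     - aw_sum (a * q) b c q k + a * b * aw_sum (a * q) b c q k
     + a * c * aw_sum (a * q) b c q k - a^2 * b * c * aw_sum (a * q) b c q k
    = ?S (\<lambda>v w t. aw_term a b c q k v w t + a^2 * aw_term a b c q k v w (t + 1)
     - a * aw_term a b c q (k + 1) v w (t + 1) - a * aw_term a b c q (k - 1) v w t
     - aw_term (a * q) b c q k v w t
     + a * b * aw_term (a * q) b c q k (v - 1) w (t + 1)
     + a * c * aw_term (a * q) b c q k v (w - 1) (t + 1)
     - a^2 * b * c * aw_term (a * q) b c q k (v - 1) (w - 1) (t + 2))"
    unfolding split_def sum.distrib sum_subtractf sum_distrib_left[symmetric]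
    by (simp only: eqs[unfolded split_def, symmetric])
  also have "\<dots> = 0"
    unfolding aw_term_rec[OF assms] by simp
  finally show ?thesis by (simp add: algebra_simps power2_eq_square)
qed

end

section \<open>Chebyshev expansion of the powers of 2x\<close>

text \<open>\<open>cheb_coeff n k\<close> below is the coefficient of \<open>U\<^sub>k\<close> in the expansion of \<open>(2x)\<^sup>n\<close> in Chebyshev
  polynomials of the second kind; it is extended antisymmetrically about \<open>k = -1\<close>.\<close>

definition cheb :: "nat \<Rightarrow> int \<Rightarrow> int" where
  "cheb n k = rbinom n (of_int (int n - k) / 2)"

lemma cheb_eq:
  "cheb n k = (if even (int n - k) \<and> k \<le> int n \<and> - int n \<le> k then int (n choose nat ((int n - k) div 2)) else 0)"
proof (cases "even (int n - k)")
  case True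
  then obtain m where m: "int n - k = 2 * m" by (elim evenE)
  have r: "of_int (int n - k) / 2 = (of_int m :: rat)" unfolding m by simp
  have "of_int m \<le> (of_nat n :: rat) \<longleftrightarrow> m \<le> int n"
    by (metis of_int_le_iff of_int_of_nat_eq)
  moreover have "m \<le> int n \<longleftrightarrow> - int n \<le> k" "0 \<le> m \<longleftrightarrow> k \<le> int n" using m by linarith+
  ultimately show ?thesis
    unfolding cheb_def r rbinom_def m by simp
next
  case False
  have "of_int (int n - k) / 2 \<notin> (\<int> :: rat set)"
  proof
    assume "of_int (int n - k) / 2 \<in> (\<int> :: rat set)"
    then obtain m where "of_int (int n - k) / 2 = (of_int m :: rat)" by (elim Ints_cases)
    then have "of_int (int n - k) = (of_int (2 * m) :: rat)" by (simp add: field_simps)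
    then have "int n - k = 2 * m" by (simp only: of_int_eq_iff)
    with False show False by simp
  qed
  then show ?thesis using False unfolding cheb_def rbinom_def by auto
qed

text \<open>\<open>cheb n k\<close> is the coefficient of z^k in (z + 1/z)^n, so this is Pascal's
  rule, and \<open>cheb_minus\<close> is the symmetry z -> 1/z.\<close>

lemma cheb_Suc: "cheb (Suc n) k = cheb n (k - 1) + cheb n (k + 1)"
proof (cases "even (int (Suc n) - k)")
  case True
  then obtain m where m: "int (Suc n) - k = 2 * m" by (elim evenE)
  then have k: "k = int n + 1 - 2 * m" by simp
  have e: "cheb (Suc n) k = (if 0 \<le> m \<and> m \<le> int n + 1 then int (Suc n choose nat m) else 0)"
    "cheb n (k - 1) = (if 0 \<le> m \<and> m \<le> int n then int (n choose nat m) else 0)"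
    "cheb n (k + 1) = (if 1 \<le> m \<and> m \<le> int n + 1 then int (n choose nat (m - 1)) else 0)"
    unfolding cheb_eq k by (auto simp: algebra_simps)
  show ?thesis
  proof (cases "1 \<le> m \<and> m \<le> int n + 1")
    case True
    define j where "j = nat (m - 1)"
    have j: "m = int (Suc j)" "j \<le> n" using True by (auto simp: j_def)
    show ?thesis unfolding e j(1) using j(2)
      by (auto simp: nat_add_distrib not_le binomial_eq_0)
  qed (auto simp: e)
qed (auto simp: cheb_eq)

lemma cheb_minus: "cheb n (- k) = cheb n k"
proof (cases "even (int n - k) \<and> k \<le> int n \<and> - int n \<le> k")
  case True
  then have "even (int n - k)" by blast
  then obtain m where m: "int n - k = 2 * m" by (elim evenE)
  then have k: "k = int n - 2 * m" by simp
  with True have "0 \<le> m" "m \<le> int n" by linarith+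
  then have "n choose nat m = n choose nat (int n - m)"
    by (subst binomial_symmetric) (auto simp: nat_diff_distrib)
  moreover have "int n + k = 2 * (int n - m)" using k by simp
  ultimately show ?thesis using True
    unfolding cheb_eq by (auto simp: m)
qed (auto simp: cheb_eq)

definition cheb_coeff :: "nat \<Rightarrow> int \<Rightarrow> int" where
  "cheb_coeff n k = cheb n k - cheb n (k + 2)"

text \<open>This mirrors 2x U_k = U_{k+1} + U_{k-1}.\<close>

lemma cheb_coeff_Suc: "cheb_coeff (Suc n) k = cheb_coeff n (k - 1) + cheb_coeff n (k + 1)"
  by (simp add: cheb_coeff_def cheb_Suc algebra_simps)

lemma cheb_coeff_minus_1: "cheb_coeff n (- 1) = 0"
  using cheb_minus[of n 1] by (simp add: cheb_coeff_def)

lemma cheb_coeff_eq_0: "k > int n \<Longrightarrow> cheb_coeff n k = 0"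
  by (simp add: cheb_coeff_def cheb_eq)

lemma cheb_coeff_0: "cheb_coeff 0 0 = 1"
  by (simp add: cheb_coeff_def cheb_eq)

text \<open>Summation by parts moves multiplication by 2x from the coefficients to \<open>S\<close>.
  The boundary terms vanish: the coefficient at -1 by antisymmetry, S(-1) by assumption, and the
  coefficients beyond n.\<close>

lemma sum_cheb_coeff_Suc:
  fixes S :: "int \<Rightarrow> 'a::field_char_0"
  assumes "S (- 1) = 0"
  shows "(\<Sum>k\<le>Suc n. of_int (cheb_coeff (Suc n) (int k)) * S (int k)) =
    (\<Sum>k\<le>n. of_int (cheb_coeff n (int k)) * (S (int k + 1) + S (int k - 1)))"
proof -
  let ?c = "\<lambda>k. of_int (cheb_coeff n k) :: 'a"
  have "(\<Sum>k\<le>Suc n. of_int (cheb_coeff (Suc n) (int k)) * S (int k)) =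
    (\<Sum>k\<le>Suc n. ?c (int k - 1) * S (int k)) + (\<Sum>k\<le>Suc n. ?c (int k + 1) * S (int k))"
    by (simp only: cheb_coeff_Suc of_int_add distrib_right sum.distrib)
  also have "(\<Sum>k\<le>Suc n. ?c (int k - 1) * S (int k)) = (\<Sum>k\<le>n. ?c (int k) * S (int k + 1))"
    by (subst sum.atMost_Suc_shift) (simp add: cheb_coeff_minus_1 add.commute)
  also have "(\<Sum>k\<le>Suc n. ?c (int k + 1) * S (int k)) = (\<Sum>k\<le>Suc (Suc n). ?c (int k) * S (int k - 1))"
    by (subst sum.atMost_Suc_shift[of _ "Suc n"]) (simp add: assms add.commute)
  also have "\<dots> = (\<Sum>k\<le>n. ?c (int k) * S (int k - 1))"
    by (simp add: cheb_coeff_eq_0)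
  finally show ?thesis by (simp add: sum.distrib distrib_left)
qed

section \<open>The functional M_a\<close>

text \<open>The value M_a(x^n), read off from the expansion of (2x)^n in the U_k and M_a(U_k) = S_k.
  Its linear extension \<open>sum_functional\<close> is M_a.\<close>

definition moment_sum :: "'a::field_char_0 \<Rightarrow> 'a \<Rightarrow> 'a \<Rightarrow> 'a \<Rightarrow> nat \<Rightarrow> 'a" where
  "moment_sum a b c q n = (\<Sum>k\<le>n. of_int (cheb_coeff n (int k)) * aw_sum a b c q (int k)) / 2 ^ n"

definition sum_functional :: "'a::field_char_0 \<Rightarrow> 'a \<Rightarrow> 'a \<Rightarrow> 'a \<Rightarrow> 'a poly \<Rightarrow> 'a" where
  "sum_functional a b c q p = (\<Sum>i\<le>degree p. coeff p i * moment_sum a b c q i)"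

lemma sum_functional_eq: "degree p \<le> N \<Longrightarrow> sum_functional a b c q p = (\<Sum>i\<le>N. coeff p i * moment_sum a b c q i)"
  unfolding sum_functional_def by (intro sum.mono_neutral_left) (auto simp: coeff_eq_0)

lemma sum_functional_add: "sum_functional a b c q (p + r) = sum_functional a b c q p + sum_functional a b c q r"
proof -
  let ?N = "max (degree p) (degree r)"
  show ?thesis
    using sum_functional_eq[of p ?N] sum_functional_eq[of r ?N] sum_functional_eq[OF degree_add_le_max[of p r]]
    by (simp add: sum.distrib distrib_right)
qed

lemma sum_functional_smult: "sum_functional a b c q (smult s p) = s * sum_functional a b c q p"
  unfolding sum_functional_eq[OF degree_smult_le[of s p]] sum_functional_eq[OF order_refl[of "degree p"]]
  by (simp only: coeff_smult sum_distrib_left mult.assoc)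

lemma sum_functional_diff: "sum_functional a b c q (p - r) = sum_functional a b c q p - sum_functional a b c q r"
  using sum_functional_add[of a b c q "p - r" r] by simp

lemma sum_functional_linear: "Vector_Spaces.linear smult (*) (sum_functional a b c q)"
proof -
  interpret V: vector_space_pair "smult :: 'a \<Rightarrow> 'a poly \<Rightarrow> 'a poly" "(*) :: 'a \<Rightarrow> 'a \<Rightarrow> 'a"
    by unfold_locales (auto simp: algebra_simps smult_add_left smult_add_right)
  show ?thesis
    unfolding Vector_Spaces.linear_iff
    using sum_functional_add sum_functional_smult V.vs1.vector_space_axioms V.vs2.vector_space_axioms by blast
qed

lemma sum_functional_monom: "sum_functional a b c q ([:0, 1:] ^ n) = moment_sum a b c q n"
proof -
  have "[:0, 1:] ^ n = (monom 1 n :: 'a poly)" by (simp add: monom_altdef)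
  then show ?thesis
    by (simp add: sum_functional_eq[of _ n] degree_monom_eq sum.delta if_distrib[of "\<lambda>x. x * _"] cong: if_cong)
qed

lemma sum_functional_pCons: "sum_functional a b c q ([:0, 1:] * p) = (\<Sum>i\<le>degree p. coeff p i * moment_sum a b c q (Suc i))"
proof -
  have "sum_functional a b c q ([:0, 1:] * p) = (\<Sum>i\<le>Suc (degree p). coeff (pCons 0 p) i * moment_sum a b c q i)"
    by (subst sum_functional_eq[of _ "Suc (degree p)"]) (simp_all add: degree_pCons_le)
  then show ?thesis by (simp only: sum.atMost_Suc_shift coeff_pCons_0 coeff_pCons_Suc) simp
qed

context qgeneric
begin

text \<open>The Chebyshev coefficients do not involve a, so \<open>aw_sum_rec\<close> transfers term
  by term; the next moment replaces S_k by S_{k+1} + S_{k-1}, where S_{-1} = 0.\<close>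

lemma moment_sum_rec:
  assumes "a \<noteq> 0"
  shows "(1 + a^2) * moment_sum a b c q n - 2 * a * moment_sum a b c q (Suc n)
    = (1 - a * b) * (1 - a * c) * moment_sum (a * q) b c q n"
proof -
  let ?c = "\<lambda>k. of_int (cheb_coeff n (int k)) :: 'a"
  have "2 * moment_sum a b c q (Suc n) = (\<Sum>k\<le>n. ?c k * (aw_sum a b c q (int k + 1) + aw_sum a b c q (int k - 1))) / 2 ^ n"
    unfolding moment_sum_def by (subst sum_cheb_coeff_Suc) (simp_all add: aw_sum_negative)
  then have "2 * a * moment_sum a b c q (Suc n) =
     a * ((\<Sum>k\<le>n. ?c k * (aw_sum a b c q (int k + 1) + aw_sum a b c q (int k - 1))) / 2 ^ n)"
    by (metis mult.assoc mult.commute)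
  then have "(1 + a^2) * moment_sum a b c q n - 2 * a * moment_sum a b c q (Suc n) =
    (\<Sum>k\<le>n. ?c k * ((1 + a^2) * aw_sum a b c q (int k)
       - a * (aw_sum a b c q (int k + 1) + aw_sum a b c q (int k - 1)))) / 2 ^ n"
    unfolding moment_sum_def
    by (simp add: sum_distrib_left sum_subtractf right_diff_distrib diff_divide_distrib mult.left_commute)
  also have "\<dots> = (\<Sum>k\<le>n. ?c k * ((1 - a * b) * (1 - a * c) * aw_sum (a * q) b c q (int k))) / 2 ^ n"
    by (simp only: aw_sum_rec[OF of_nat_0_le_iff assms])
  also have "\<dots> = (1 - a * b) * (1 - a * c) * moment_sum (a * q) b c q n"
    unfolding moment_sum_def by (simp add: sum_distrib_left mult_ac)
  finally show ?thesis .
qed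

lemma sum_functional_rec:
  assumes "a \<noteq> 0"
  shows "sum_functional a b c q ([:1 + a^2, - 2 * a:] * p) = (1 - a * b) * (1 - a * c) * sum_functional (a * q) b c q p"
proof -
  have "[:1 + a^2, - 2 * a:] * p = smult (1 + a^2) p - smult (2 * a) ([:0, 1:] * p)"
    by simp
  then have "sum_functional a b c q ([:1 + a^2, - 2 * a:] * p) =
      (1 + a^2) * sum_functional a b c q p - 2 * a * sum_functional a b c q ([:0, 1:] * p)"
    by (simp only: sum_functional_diff sum_functional_smult)
  also have "\<dots> = (\<Sum>i\<le>degree p. coeff p i * ((1 + a^2) * moment_sum a b c q i - 2 * a * moment_sum a b c q (Suc i)))"
    unfolding sum_functional_pCons sum_functional_def[of _ _ _ _ p]
    by (simp only: sum_distrib_left sum_subtractf right_diff_distrib mult.left_commute)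
  finally show ?thesis
    unfolding moment_sum_rec[OF assms] sum_functional_def[of _ _ _ _ p] by (simp add: sum_distrib_left mult_ac)
qed

section \<open>Pairing the Askey-Wilson polynomials with the basis phi_j\<close>

text \<open>For x = cos(theta) this is (a e^{i theta}; q)_j (a e^{-i theta}; q)_j, the usual
  Askey-Wilson basis.\<close>

definition aw_phi :: "'a \<Rightarrow> nat \<Rightarrow> 'a poly" where
  "aw_phi a j = (\<Prod>i<j. [:1 + (a * q ^ i)^2, - 2 * (a * q ^ i):])"

text \<open>Without its factor i = 0, phi_{j+1} is phi_j for the parameter aq, and
  \<open>sum_functional_rec\<close> trades that factor for (1 - ab)(1 - ac) and a for aq. Hence the
  induction is over all a.\<close>

lemma sum_functional_phi: "a \<noteq> 0 \<Longrightarrow> sum_functional a b c q (aw_phi a j) = qpoch (a * b) q j * qpoch (a * c) q j"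
proof (induction j arbitrary: a)
  case 0
  have "sum_functional a b c q ([:0, 1:] ^ 0) = 1"
    unfolding sum_functional_monom by (simp add: moment_sum_def cheb_coeff_0 aw_sum_0)
  then show ?case by (simp add: aw_phi_def qpoch_def)
next
  case (Suc j)
  have "aw_phi a (Suc j) = [:1 + a^2, - 2 * a:] * aw_phi (a * q) j"
    unfolding aw_phi_def by (subst prod.lessThan_Suc_shift) (simp add: mult.assoc)
  moreover have "qpoch (a * d) q (Suc j) = (1 - a * d) * qpoch (a * q * d) q j" for d
    unfolding qpoch_def by (subst prod.lessThan_Suc_shift) (simp add: mult_ac)
  ultimately show ?case
    using Suc.IH[of "a * q"] Suc.prems q_nz
    by (simp only: sum_functional_rec[OF Suc.prems]) simp
qed

lemma aw_A_d0: "a \<noteq> 0 \<Longrightarrow> aw_A a b c 0 q n = (1 - a * b * q ^ n) * (1 - a * c * q ^ n) / a"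
  by (simp add: aw_A_def)

lemma aw_C_d0: "aw_C a b c 0 q n = (if n = 0 then 0 else a * (1 - q ^ n) * (1 - b * c * q ^ (n - 1)))"
  by (cases n) (simp_all add: aw_C_def)

text \<open>The claimed M_a(P_n phi_j) without the factor (ab;q)_j (ac;q)_j. The last product
  vanishes for j < n, which expresses orthogonality.\<close>

definition aw_pairing :: "'a \<Rightarrow> 'a \<Rightarrow> 'a \<Rightarrow> nat \<Rightarrow> nat \<Rightarrow> 'a" where
  "aw_pairing a b c n j = (- a / 2) ^ n * qpoch (b * c) q n * (\<Prod>i<n. q ^ i - q ^ j)"

lemma aw_pairing_Suc: "aw_pairing a b c (Suc n) j = (- a / 2) * (1 - b * c * q ^ n) * (q ^ n - q ^ j) * aw_pairing a b c n j"
  by (simp add: aw_pairing_def qpoch_def)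

text \<open>In the shifted product the factor i = 0 is 1 - q^{j+1}, and each other one is q times a
  factor of the old product.\<close>

lemma aw_pairing_shift: "aw_pairing a b c (Suc n) (Suc j) = (- a / 2) * (1 - b * c * q ^ n) * q ^ n * (1 - q ^ Suc j) * aw_pairing a b c n j"
proof -
  have "(\<Prod>i<Suc n. q ^ i - q ^ Suc j) = (1 - q ^ Suc j) * (\<Prod>i<n. q * (q ^ i - q ^ j))"
    by (subst prod.lessThan_Suc_shift) (simp add: right_diff_distrib)
  also have "\<dots> = (1 - q ^ Suc j) * (q ^ n * (\<Prod>i<n. q ^ i - q ^ j))"
    by (simp add: prod.distrib)
  finally show ?thesis by (simp add: aw_pairing_def qpoch_def mult_ac)
qed

text \<open>The defining relation phi_{j+1} = (1 + a^2 q^{2j} - 2 a q^j x) phi_j, solved for x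
  phi_j.\<close>

lemma sum_functional_X_phi:
  assumes "a \<noteq> 0"
  shows "sum_functional a b c q ([:0, 1:] * p * aw_phi a j) =
    ((1 + (a * q ^ j)^2) * sum_functional a b c q (p * aw_phi a j) - sum_functional a b c q (p * aw_phi a (Suc j))) / (2 * (a * q ^ j))"
proof -
  have "p * aw_phi a (Suc j) = p * aw_phi a j * [:1 + (a * q ^ j)^2, - 2 * (a * q ^ j):]"
    by (simp only: aw_phi_def prod.lessThan_Suc mult.assoc)
  also have "\<dots> = smult (1 + (a * q ^ j)^2) (p * aw_phi a j) - smult (2 * (a * q ^ j)) ([:0, 1:] * p * aw_phi a j)"
    by (simp add: mult.commute)
  finally have "sum_functional a b c q (p * aw_phi a (Suc j)) = (1 + (a * q ^ j)^2) * sum_functional a b c q (p * aw_phi a j)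
      - 2 * (a * q ^ j) * sum_functional a b c q ([:0, 1:] * p * aw_phi a j)"
    by (simp only: sum_functional_diff sum_functional_smult)
  then show ?thesis using assms q_nz by (simp del: mult_pCons_left)
qed

text \<open>Strong induction on n along the three-term recurrence, for all j at once because
  multiplication by x brings in phi_{j+1}.\<close>

lemma sum_functional_poly_phi:
  assumes a: "a \<noteq> 0"
  shows "sum_functional a b c q (aw_poly a b c 0 q n * aw_phi a j) =
    qpoch (a * b) q j * qpoch (a * c) q j * aw_pairing a b c n j"
proof (induction n arbitrary: j rule: less_induct)
  case (less n)
  define F where "F j = qpoch (a * b) q j * qpoch (a * c) q j" for j
  have FS: "F (Suc j) = (1 - a * b * q ^ j) * (1 - a * c * q ^ j) * F j" for j
    by (simp add: F_def qpoch_def)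
  have rec: "sum_functional a b c q (([:0, 1:] - [:s:]) * p * aw_phi a j) =
    ((1 + (a * q ^ j)^2) * sum_functional a b c q (p * aw_phi a j) - sum_functional a b c q (p * aw_phi a (Suc j))) / (2 * (a * q ^ j))
    - s * sum_functional a b c q (p * aw_phi a j)" for s p
  proof -
    have "([:0, 1:] - [:s:]) * p * aw_phi a j = [:0, 1:] * p * aw_phi a j - smult s (p * aw_phi a j)"
      by (simp add: algebra_simps)
    then show ?thesis by (simp only: sum_functional_diff sum_functional_smult sum_functional_X_phi[OF a])
  qed
  consider "n = 0" | "n = 1" | m where "n = Suc (Suc m)"
    by (metis One_nat_def not0_implies_Suc)
  then show ?case
  proof cases
    case 1
    then show ?thesis by (simp add: sum_functional_phi[OF a] aw_pairing_def qpoch_def)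
  next
    case 2
    have "sum_functional a b c q (aw_poly a b c 0 q n * aw_phi a j) =
       sum_functional a b c q (([:0, 1:] - [:aw_b a b c 0 q 0:]) * 1 * aw_phi a j)"
      unfolding 2 by simp
    also have "\<dots> = ((1 + (a * q ^ j)^2) * F j - F (Suc j)) / (2 * (a * q ^ j)) - aw_b a b c 0 q 0 * F j"
      unfolding rec mult_1 sum_functional_phi[OF a] F_def ..
    also have "\<dots> = F j * aw_pairing a b c n j"
      using a q_nz unfolding FS aw_pairing_def qpoch_def aw_b_def aw_A_d0[OF a] aw_C_d0 2
      by (simp add: field_simps power2_eq_square)
    finally show ?thesis by (simp add: F_def)
  next
    case (3 m)
    let ?G = "aw_pairing a b c"
    have IH: "sum_functional a b c q (aw_poly a b c 0 q (Suc m) * aw_phi a j) = F j * ?G (Suc m) j"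
      "sum_functional a b c q (aw_poly a b c 0 q m * aw_phi a j) = F j * ?G m j" for j
      using less 3 by (simp_all add: F_def)
    have "aw_poly a b c 0 q n * aw_phi a j = ([:0, 1:] - [:aw_b a b c 0 q (Suc m):]) * aw_poly a b c 0 q (Suc m) * aw_phi a j
       - smult (aw_lambda a b c 0 q (Suc m)) (aw_poly a b c 0 q m * aw_phi a j)"
      unfolding 3 aw_poly.simps left_diff_distrib mult_smult_left by (rule refl)
    then have "sum_functional a b c q (aw_poly a b c 0 q n * aw_phi a j) =
      ((1 + (a * q ^ j)^2) * (F j * ?G (Suc m) j) - F (Suc j) * ?G (Suc m) (Suc j)) / (2 * (a * q ^ j))
      - aw_b a b c 0 q (Suc m) * (F j * ?G (Suc m) j) - aw_lambda a b c 0 q (Suc m) * (F j * ?G m j)"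
      by (simp only: sum_functional_diff sum_functional_smult rec IH)
    also have "\<dots> = F j * ?G (Suc (Suc m)) j"
    proof -
      \<comment> \<open>All pairings are now multiples of \<open>g\<close>, so a rational identity
        in a, b, c, q, X, Y remains; \<open>Y\<close> occurs in the denominator.\<close>
      define X Y g f where "X = q ^ m" "Y = q ^ j" "g = ?G m j" "f = F j"
      note defs = this
      have Y: "Y \<noteq> 0" using q_nz by (simp add: defs)
      show ?thesis
        unfolding FS aw_pairing_shift
        unfolding aw_pairing_Suc aw_b_def aw_lambda_def aw_A_d0[OF a] aw_C_d0 power_Suc
          diff_Suc_1 defs[symmetric]
        using a Y by (simp add: field_simps power2_eq_square)
    qed
    finally show ?thesis by (simp add: F_def 3)
  qed
qed

lemma aw_functional_d0:
  assumes "a \<noteq> 0"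
  shows "aw_functional a b c 0 q = sum_functional a b c q"
  unfolding aw_functional_def
proof (rule the1_equality[OF ex1_aw_functional])
  have "sum_functional a b c q (aw_poly a b c 0 q n) = 0" if "n \<ge> 1" for n
    using sum_functional_poly_phi[OF assms, of b c n 0] that
    \<comment> \<open>At j = 0 the factor i = 0 of the product is q^0 - q^0.\<close>
    by (auto simp: aw_phi_def aw_pairing_def intro!: bexI[of _ 0])
  moreover have "sum_functional a b c q 1 = 1"
    using sum_functional_phi[OF assms, of b c 0] by (simp add: aw_phi_def qpoch_def)
  ultimately show "is_aw_functional a b c 0 q (sum_functional a b c q)"
    unfolding is_aw_functional_def using sum_functional_linear by blast
qed

end

theorem theorem2p3:
  fixes a b c q :: "'a::field_char_0" and n :: nat
  assumes "a \<noteq> 0"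
    and "q \<noteq> 0"
    and "\<And>m::nat. m \<ge> 1 \<Longrightarrow> q ^ m \<noteq> 1"
  shows "2 ^ n * aw_moment a b c 0 q n =
    (\<Sum>k=0..n.
       of_int (rbinom n (of_int (int n - int k) / 2) - rbinom n (of_int (int n - int k) / 2 - 1)) *
       (\<Sum>(u, v, w, t)\<in>aw_index_set k.
          a ^ u * b ^ v * c ^ w * (- 1) powi t * q powi (t * (t + 1) div 2) *
          qbinom q (int u + int v + t) (int v) *
          qbinom q (int v + int w + t) (int w) *
          qbinom q (int w + int u + t) (int u)))"
proof -
  interpret qgeneric q
    using assms by unfold_locales auto
  have cheb: "rbinom n (of_int (int n - int k) / 2) - rbinom n (of_int (int n - int k) / 2 - 1) = cheb_coeff n (int k)" for k
  proof -
    \<comment> \<open>Raising k by 2 lowers (n - k)/2 by 1.\<close>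
    have "of_int (int n - int k) / 2 - 1 = (of_int (int n - (int k + 2)) / 2 :: rat)"
      by (simp add: field_simps)
    then show ?thesis by (simp only: cheb_coeff_def cheb_def)
  qed
  have "2 ^ n * aw_moment a b c 0 q n = (\<Sum>k\<le>n. of_int (cheb_coeff n (int k)) * aw_sum a b c q (int k))"
    unfolding aw_moment_def aw_functional_d0[OF assms(1)] sum_functional_monom moment_sum_def by simp
  then show ?thesis
    unfolding cheb aw_sum_eq_index_set[OF assms(1)] atLeast0AtMost .
qed

end
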